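(* Let $k$ be a positive integer and $H$ an arbitrary graph on $n$ vertices such that $\alpha(H)\ge k+1$. Then $\alpha(H) - 1 \le \dim \mathfrak{C}(H,k) \le n-1$.
   Context: $\alpha(H)$ denotes the stability number of $H$, the maximum cardinality of a stable set (set of pairwise non-adjacent vertices) in $H$. Identifying the vertex set of $H$ with $[n]$, $\mathfrak{C}(H,k)\subseteq\mathbb{Q}^n$ is the convex hull of the incidence vectors $\chi^S\in\{0,1\}^n$ ($\chi^S_i=1$ iff $i\in S$) of stable sets $S$ of cardinality exactly $k$ in $H$. $\dim$ denotes the (affine) dimension of a polytope. *)

theory Defs
  imports "HOL-Analysis.Cartesian_Space"
begin

text \<open>A graph on \<open>n\<close> vertices is given by its adjacency relation on a finite vertex type
  \<open>'n\<close> with \<open>CARD('n) = n\<close>, so that vectors of \<open>\<rat>\<^sup>n\<close> have type \<open>rat ^ 'n\<close>.\<close>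

definition graph :: "('n \<Rightarrow> 'n \<Rightarrow> bool) \<Rightarrow> bool" where
  "graph H \<longleftrightarrow> symp H \<and> irreflp H"

definition stable_set :: "('n \<Rightarrow> 'n \<Rightarrow> bool) \<Rightarrow> 'n set \<Rightarrow> bool" where
  "stable_set H S \<longleftrightarrow> (\<forall>x\<in>S. \<forall>y\<in>S. x \<noteq> y \<longrightarrow> \<not> H x y)"

definition stability_number :: "('n::finite \<Rightarrow> 'n \<Rightarrow> bool) \<Rightarrow> nat" where
  "stability_number H = Max {card S | S. stable_set H S}"

definition incidence_vector :: "'n::finite set \<Rightarrow> rat ^ 'n" where
  "incidence_vector S = (\<chi> i. if i \<in> S then 1 else 0)"

text \<open>The library's \<open>convex\<close>, \<open>affine\<close> and \<open>aff_dim\<close> require a real vector space; the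
  following are the same notions over the rationals, with \<open>*s\<close> as scalar multiplication.\<close>

definition rat_convex :: "(rat ^ 'n::finite) set \<Rightarrow> bool" where
  "rat_convex C \<longleftrightarrow>
    (\<forall>x\<in>C. \<forall>y\<in>C. \<forall>u\<ge>0. \<forall>v\<ge>0. u + v = 1 \<longrightarrow> u *s x + v *s y \<in> C)"

definition rat_affine :: "(rat ^ 'n::finite) set \<Rightarrow> bool" where
  "rat_affine A \<longleftrightarrow> (\<forall>x\<in>A. \<forall>y\<in>A. \<forall>u v. u + v = 1 \<longrightarrow> u *s x + v *s y \<in> A)"

text \<open>The dimension of the linear subspace parallel to the affine hull; \<open>vec.dim\<close> is
  linear dimension over the scalar field, here the rationals. As for \<open>aff_dim\<close>, the empty
  set has dimension \<open>-1\<close>.\<close>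

definition rat_aff_dim :: "(rat ^ 'n::finite) set \<Rightarrow> int" where
  "rat_aff_dim P =
    (if P = {} then - 1
     else int (vec.dim {x - y | x y. x \<in> rat_affine hull P \<and> y \<in> rat_affine hull P}))"

definition stable_set_polytope ::
  "('n::finite \<Rightarrow> 'n \<Rightarrow> bool) \<Rightarrow> nat \<Rightarrow> (rat ^ 'n) set" where
  "stable_set_polytope H k =
    rat_convex hull {incidence_vector S | S. stable_set H S \<and> card S = k}"

end

theory Submission
  imports Defs
begin

text \<open>The upper bound holds because the coordinates of every point of the polytope sum to
  \<open>k\<close>. For the lower bound, let \<open>A\<close> be a maximum stable set. Since \<open>card A \<ge> k + 1\<close>, any two
  \<open>x, y \<in> A\<close> are exchanged by two stable \<open>k\<close>-subsets \<open>insert x S\<close> and \<open>insert y S\<close> of \<open>A\<close>, so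
  \<open>e\<^sub>x - e\<^sub>y\<close> is a direction of the polytope. Adding a single \<open>e\<^sub>a\<close> to the directions thus makes
  them span all \<open>e\<^sub>x\<close> with \<open>x \<in> A\<close>.\<close>

lemma stable_set_subset:
  assumes "stable_set H A" "B \<subseteq> A"
  shows "stable_set H B"
  using assms unfolding stable_set_def by blast

lemma stability_number_attained:
  fixes H :: "'n::finite \<Rightarrow> 'n \<Rightarrow> bool"
  obtains A where "stable_set H A" "card A = stability_number H"
proof -
  \<comment> \<open>The empty set is always stable, so the maximum is taken over a nonempty
    set.\<close>
  have "{card S | S. stable_set H S} \<noteq> {}"
    unfolding stable_set_def by blast
  moreover have "finite {card S | S. stable_set H S}"
    by simp
  ultimately have "stability_number H \<in> {card S | S. stable_set H S}"
    unfolding stability_number_def by (rule Max_in[rotated])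
  then show thesis
    using that by auto
qed

lemma sum_incidence_vector: "(\<Sum>i\<in>UNIV. incidence_vector S $ i) = of_nat (card S)"
  by (simp add: incidence_vector_def sum.If_cases)

lemma incidence_vector_insert:
  assumes "x \<notin> S"
  shows "incidence_vector (insert x S) = axis x 1 + incidence_vector S"
  using assms by (auto simp: vec_eq_iff incidence_vector_def axis_def)

lemma rat_affine_coordinate_sum: "rat_affine {v. (\<Sum>i\<in>UNIV. v $ i) = c}"
  by (auto simp: rat_affine_def sum.distrib simp flip: sum_distrib_left distrib_right)

lemma rat_affine_imp_rat_convex: "rat_affine A \<Longrightarrow> rat_convex A"
  unfolding rat_affine_def rat_convex_def by blast

text \<open>A hyperplane of constant coordinate sum is affine, so it contains the affine hull; hence
  all directions have coordinate sum 0 and lie in a proper subspace.\<close>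

lemma rat_aff_dim_le_if_coordinate_sum:
  fixes P :: "(rat ^ 'n::finite) set"
  assumes "\<And>v. v \<in> P \<Longrightarrow> (\<Sum>i\<in>UNIV. v $ i) = c"
  shows "rat_aff_dim P \<le> int CARD('n) - 1"
proof -
  let ?D = "{x - y | x y. x \<in> rat_affine hull P \<and> y \<in> rat_affine hull P}"
  let ?Z = "{v :: rat ^ 'n. (\<Sum>i\<in>UNIV. v $ i) = 0}"
  have hull: "rat_affine hull P \<subseteq> {v. (\<Sum>i\<in>UNIV. v $ i) = c}"
    by (rule hull_minimal) (use assms rat_affine_coordinate_sum in auto)
  have "?D \<subseteq> ?Z"
    by (auto simp: sum_subtractf dest!: subsetD[OF hull])
  moreover have "vec.subspace ?Z"
    by (auto simp: vec.subspace_def sum.distrib simp flip: sum_distrib_left)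
  ultimately have "vec.span ?D \<subseteq> ?Z"
    by (rule vec.span_minimal)
  \<comment> \<open>\<open>undefined\<close> is just some index: any unit vector has coordinate sum
    1, which makes \<open>?Z\<close> proper.\<close>
  moreover have "axis undefined 1 \<notin> ?Z"
    by (simp add: axis_def)
  ultimately have "vec.span ?D \<subset> vec.span UNIV"
    by auto
  then have "vec.dim ?D < vec.dim (UNIV :: (rat ^ 'n) set)"
    by (rule vec.dim_psubset)
  then show ?thesis
    by (simp add: rat_aff_dim_def card_cart_basis)
qed

text \<open>The loss of 1 is the price of the extra generator \<open>axis a 1\<close>, without which
  the directions need not span the independent unit vectors of \<open>A\<close>.\<close>

lemma rat_aff_dim_ge_if_axis_differences:
  fixes P :: "(rat ^ 'n::finite) set"
  assumes "P \<noteq> {}" "a \<in> A"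
    and diff: "\<And>x. x \<in> A \<Longrightarrow> x \<noteq> a \<Longrightarrow> \<exists>u\<in>P. \<exists>v\<in>P. axis x 1 - axis a 1 = u - v"
  shows "int (card A) - 1 \<le> rat_aff_dim P"
proof -
  let ?D = "{x - y | x y. x \<in> rat_affine hull P \<and> y \<in> rat_affine hull P}"
  let ?E = "insert (axis a 1) ?D"
  let ?B = "(\<lambda>x. axis x 1 :: rat ^ 'n) ` A"
  have "axis x 1 \<in> vec.span ?E" if "x \<in> A" for x
  proof (cases "x = a")
    case True
    then show ?thesis by (simp add: vec.span_base)
  next
    case False
    then obtain u v where "u \<in> P" "v \<in> P" and uv: "axis x 1 - axis a 1 = u - v"
      using diff \<open>x \<in> A\<close> by blast
    then have "axis x 1 - axis a 1 \<in> ?D"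
      by (auto intro: hull_inc)
    then have "(axis x 1 - axis a 1) + axis a 1 \<in> vec.span ?E"
      by (intro vec.span_add vec.span_base) auto
    then show ?thesis by simp
  qed
  then have "?B \<subseteq> vec.span ?E"
    by blast
  moreover have "vec.independent ?B"
    by (rule vec.independent_mono[OF independent_cart_basis]) (auto simp: cart_basis_def)
  ultimately have "card ?B \<le> vec.dim (vec.span ?E)"
    by (rule vec.independent_card_le_dim)
  moreover have "card ?B = card A"
    by (rule card_image) (auto simp: inj_on_def axis_eq_axis)
  \<comment> \<open>Whether or not \<open>axis a 1\<close> already lies in the span of
    \<open>?D\<close>, inserting it raises the dimension by at most 1.\<close>
  ultimately have "card A \<le> vec.dim ?D + 1"
    by (simp add: vec.dim_insert split: if_splits)
  then show ?thesis
    using \<open>P \<noteq> {}\<close> by (simp add: rat_aff_dim_def)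
qed

theorem theorem2p5:
  fixes H :: "'n::finite \<Rightarrow> 'n \<Rightarrow> bool" and k :: nat
  assumes "graph H"
    and "k > 0"
    and "stability_number H \<ge> k + 1"
  shows "int (stability_number H) - 1 \<le> rat_aff_dim (stable_set_polytope H k)
    \<and> rat_aff_dim (stable_set_polytope H k) \<le> int CARD('n) - 1"
proof
  let ?P = "stable_set_polytope H k"
  obtain A where A: "stable_set H A" "card A = stability_number H"
    by (rule stability_number_attained)
  have vertex: "incidence_vector S \<in> ?P" if "S \<subseteq> A" "card S = k" for S
    unfolding stable_set_polytope_def
    using that stable_set_subset[OF A(1)] by (intro hull_inc) auto
  have "k \<le> card A"
    using A(2) assms(3) by simp
  then obtain S where "S \<subseteq> A" "card S = k"
    by (rule obtain_subset_with_card_n)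
  then have "?P \<noteq> {}"
    using vertex by blast
  obtain a where "a \<in> A"
    using A(2) assms(3) by fastforce
  have "\<exists>u\<in>?P. \<exists>v\<in>?P. axis x 1 - axis a 1 = u - v" if "x \<in> A" "x \<noteq> a" for x
  proof -
    \<comment> \<open>Here \<alpha>(H) \<ge> k + 1 enters: removing two vertices from
      \<open>A\<close> leaves at least k - 1, enough for a common part \<open>S\<close> of the two
      exchanged sets.\<close>
    have "k - 1 \<le> card (A - {x, a})"
      using A(2) assms(3) that \<open>a \<in> A\<close> by (simp add: card_Diff_subset)
    then obtain S where S: "S \<subseteq> A - {x, a}" "card S = k - 1"
      by (rule obtain_subset_with_card_n)
    then have "x \<notin> S" "a \<notin> S"
      by auto
    \<comment> \<open>As k > 0, the truncated difference k - 1 is exact, and both insertions have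
      size k.\<close>
    then have "incidence_vector (insert x S) \<in> ?P" "incidence_vector (insert a S) \<in> ?P"
      using S that \<open>a \<in> A\<close> assms(2) by (auto intro!: vertex)
    moreover have "axis x 1 - axis a 1
        = incidence_vector (insert x S) - incidence_vector (insert a S)"
      using \<open>x \<notin> S\<close> \<open>a \<notin> S\<close> by (simp add: incidence_vector_insert)
    ultimately show ?thesis
      by blast
  qed
  with \<open>?P \<noteq> {}\<close> \<open>a \<in> A\<close> show "int (stability_number H) - 1 \<le> rat_aff_dim ?P"
    unfolding A(2)[symmetric] by (rule rat_aff_dim_ge_if_axis_differences)
  \<comment> \<open>The hyperplane is affine, hence convex, so it suffices to check the generating
    incidence vectors.\<close>
  have "?P \<subseteq> {v. (\<Sum>i\<in>UNIV. v $ i) = of_nat k}"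
    unfolding stable_set_polytope_def
    by (rule hull_minimal)
      (auto simp: sum_incidence_vector rat_affine_imp_rat_convex rat_affine_coordinate_sum)
  then show "rat_aff_dim ?P \<le> int CARD('n) - 1"
    by (intro rat_aff_dim_le_if_coordinate_sum) auto
qed

end
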